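(* Let $\mathcal H$ be a real Hilbert space, let $f_1,f_2:\mathcal H\to(-\infty,+\infty]$ be proper lower semicontinuous convex functions, and let $\lambda_1,\lambda_2>0$ with $\lambda_1+\lambda_2=1$. Let $S:=\{(x,y)\in\mathcal H\times\mathcal H: x=\operatorname{Prox}_{f_1/\lambda_2}y,\ y=\operatorname{Prox}_{f_2/\lambda_1}x\}$ and define $T:S\to\operatorname{Fix}(\lambda_1\operatorname{Prox}_{f_1}+\lambda_2\operatorname{Prox}_{f_2})$ by $T(x,y)=\lambda_1x+\lambda_2y$. Then $T$ is a homeomorphism. Moreover, for every $z\in\operatorname{Fix}(\operatorname{Prox}_p)$ one has $T^{-1}(z)=(\operatorname{Prox}_{f_1}(z),\operatorname{Prox}_{f_2}(z))$. Consequently, $\operatorname{Fix}(\lambda_1\operatorname{Prox}_{f_1}+\lambda_2\operatorname{Prox}_{f_2})=L(S)$, where $L:\mathcal H\times\mathcal H\to\mathcal H:(x,y)\mapsto\lambda_1x+\lambda_2y$.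
   Context: For proper lower semicontinuous convex $f$ on $\mathcal H$, $\operatorname{Prox}_f:=(\operatorname{Id}+\partial f)^{-1}$ is the proximal mapping (single-valued, full domain), with $\partial f$ the convex subdifferential. The function $p$ is the proximal average $p(z):=\inf_{z=\lambda_1x+\lambda_2y}\big(\lambda_1f_1(x)+\lambda_2f_2(y)+\frac{\lambda_1\lambda_2}{2}\|x-y\|^2\big)$; it is proper, lower semicontinuous and convex, and it is known that $\operatorname{Prox}_p=\lambda_1\operatorname{Prox}_{f_1}+\lambda_2\operatorname{Prox}_{f_2}$. $\operatorname{Fix}T=\{x:Tx=x\}$. A homeomorphism is a continuous bijection with continuous inverse (norm topologies). *)

theory Defs
  imports "HOL-Analysis.Analysis"
begin

text \<open>Functions with values in the extended half-line \<open>(-\<infinity>, +\<infinity>]\<close> are represented as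
  \<^typ>\<open>ereal\<close>-valued functions; the value \<open>-\<infinity>\<close> is excluded by \<open>proper_fun\<close>.\<close>

definition proper_fun :: "('a \<Rightarrow> ereal) \<Rightarrow> bool" where
  "proper_fun f \<longleftrightarrow> (\<forall>x. f x \<noteq> -\<infinity>) \<and> (\<exists>x. f x \<noteq> \<infinity>)"

definition lsc_fun :: "('a::topological_space \<Rightarrow> ereal) \<Rightarrow> bool" where
  "lsc_fun f \<longleftrightarrow> (\<forall>x. f x \<le> Liminf (nhds x) f)"

text \<open>The open range of \<open>t\<close> avoids products \<open>0 * \<infinity>\<close>; on functions without the value \<open>-\<infinity>\<close>
  no sum \<open>\<infinity> + (-\<infinity>)\<close> occurs either.\<close>

definition convex_fun :: "('a::real_vector \<Rightarrow> ereal) \<Rightarrow> bool" where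
  "convex_fun f \<longleftrightarrow>
    (\<forall>x y. \<forall>t::real. 0 < t \<and> t < 1 \<longrightarrow>
      f ((1 - t) *\<^sub>R x + t *\<^sub>R y) \<le> ereal (1 - t) * f x + ereal t * f y)"

definition subdifferential :: "('a::real_inner \<Rightarrow> ereal) \<Rightarrow> 'a \<Rightarrow> 'a set" where
  "subdifferential f x = {u. \<forall>y. f x + ereal (u \<bullet> (y - x)) \<le> f y}"

text \<open>The value at \<open>y\<close> of \<open>(Id + \<partial>f)\<inverse>\<close>. The description operator is meaningful for proper
  lower semicontinuous convex \<open>f\<close> on a Hilbert space, where by Minty's theorem this set-valued
  inverse is single-valued with full domain.\<close>

definition Prox :: "('a::real_inner \<Rightarrow> ereal) \<Rightarrow> 'a \<Rightarrow> 'a" where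
  "Prox f y = (THE x. y \<in> {x + u | u. u \<in> subdifferential f x})"

definition Fix :: "('a \<Rightarrow> 'a) \<Rightarrow> 'a set" where
  "Fix F = {x. F x = x}"

definition prox_avg ::
    "real \<Rightarrow> real \<Rightarrow> ('a::real_inner \<Rightarrow> ereal) \<Rightarrow> ('a \<Rightarrow> ereal) \<Rightarrow> 'a \<Rightarrow> ereal" where
  "prox_avg l\<^sub>1 l\<^sub>2 f\<^sub>1 f\<^sub>2 z =
    (INF (x, y) \<in> {(x, y). z = l\<^sub>1 *\<^sub>R x + l\<^sub>2 *\<^sub>R y}.
      ereal l\<^sub>1 * f\<^sub>1 x + ereal l\<^sub>2 * f\<^sub>2 y + ereal (l\<^sub>1 * l\<^sub>2 / 2 * (norm (x - y))\<^sup>2))"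

definition prox_pairs ::
    "real \<Rightarrow> real \<Rightarrow> ('a::real_inner \<Rightarrow> ereal) \<Rightarrow> ('a \<Rightarrow> ereal) \<Rightarrow> ('a \<times> 'a) set" where
  "prox_pairs l\<^sub>1 l\<^sub>2 f\<^sub>1 f\<^sub>2 =
    {(x, y). x = Prox (\<lambda>v. f\<^sub>1 v / ereal l\<^sub>2) y \<and> y = Prox (\<lambda>v. f\<^sub>2 v / ereal l\<^sub>1) x}"

end

theory Submission
  imports Defs
begin

text \<open>
  Write \<open>z = l\<^sub>1 x + l\<^sub>2 y\<close>. Since \<open>l\<^sub>1 + l\<^sub>2 = 1\<close>, we have \<open>z - x = l\<^sub>2 (y - x)\<close> and
  \<open>z - y = l\<^sub>1 (x - y)\<close>. Now \<open>x = Prox (f\<^sub>1/l\<^sub>2) y\<close> says that \<open>l\<^sub>2 (y - x)\<close>, that is \<open>z - x\<close>, is a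
  subgradient of \<open>f\<^sub>1\<close> at \<open>x\<close>, which is the same as \<open>x = Prox f\<^sub>1 z\<close>; likewise the second equation
  says \<open>y = Prox f\<^sub>2 z\<close> (\<open>mem_prox_pairs_iff\<close>). Hence \<open>S\<close> is the set of pairs
  \<open>(Prox f\<^sub>1 z, Prox f\<^sub>2 z)\<close> with \<open>z\<close> fixed by \<open>l\<^sub>1 Prox f\<^sub>1 + l\<^sub>2 Prox f\<^sub>2\<close>, and
  \<open>z \<mapsto> (Prox f\<^sub>1 z, Prox f\<^sub>2 z)\<close> inverts \<open>T\<close>. It is continuous because subdifferentials are monotone,
  which makes proximal mappings nonexpansive (\<open>Prox_nonexpansive\<close>).

  All of this rests on Minty's theorem, that the inclusion defining \<open>Prox f y\<close> has a solution. The
  solution is found as the minimizer of \<open>f + (c/2) \<parallel>\<cdot> - y\<parallel>\<^sup>2\<close>: convexity and semicontinuity bound \<open>f\<close>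
  below by a constant minus a multiple of the distance to a point, strong convexity makes minimizing
  sequences Cauchy, and semicontinuity passes to the limit. The factor \<open>c\<close> is carried along so that
  the same existence result serves \<open>f\<close> and its multiples \<open>f/c\<close>.

  For the proximal average \<open>p\<close>, the identity \<open>Prox p = l\<^sub>1 Prox f\<^sub>1 + l\<^sub>2 Prox f\<^sub>2\<close> is verified by
  exhibiting the subgradient (\<open>Prox_prox_avg\<close>). The affine minorant that this subgradient provides
  makes \<open>p\<close> proper, and monotonicity of the subdifferential then makes the solution of the inclusion
  unique, so that \<open>Prox p\<close> must pick it.
\<close>

section \<open>Subgradients of proper functions\<close>

lemma proper_fun_ereal:
  assumes "proper_fun f" "f x \<noteq> \<infinity>"
  shows "f x = ereal (real_of_ereal (f x))"
  using assms unfolding proper_fun_def by (cases "f x") auto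

text \<open>A subgradient inequality against a point of finite value forces finiteness at the base point,
  so for proper functions everything can be said with real numbers.\<close>

lemma subdifferential_iff:
  assumes "proper_fun f"
  shows "u \<in> subdifferential f x \<longleftrightarrow> f x \<noteq> \<infinity> \<and>
    (\<forall>y. f y \<noteq> \<infinity> \<longrightarrow> real_of_ereal (f x) + u \<bullet> (y - x) \<le> real_of_ereal (f y))"
    (is "?lhs \<longleftrightarrow> ?rhs")
proof
  assume u: ?lhs
  obtain w where w: "f w \<noteq> \<infinity>"
    using assms unfolding proper_fun_def by blast
  have "f x + ereal (u \<bullet> (w - x)) \<le> f w"
    using u by (simp add: subdifferential_def)
  then have x: "f x \<noteq> \<infinity>"
    using w by auto
  have "real_of_ereal (f x) + u \<bullet> (y - x) \<le> real_of_ereal (f y)" if "f y \<noteq> \<infinity>" for y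
  proof -
    have "f x + ereal (u \<bullet> (y - x)) \<le> f y"
      using u by (simp add: subdifferential_def)
    then show ?thesis
      using proper_fun_ereal[OF assms x] proper_fun_ereal[OF assms that]
      by (metis ereal_less_eq(3) plus_ereal.simps(1))
  qed
  with x show ?rhs by blast
next
  assume r: ?rhs
  have "f x + ereal (u \<bullet> (y - x)) \<le> f y" for y
  proof (cases "f y = \<infinity>")
    case False
    then have "real_of_ereal (f x) + u \<bullet> (y - x) \<le> real_of_ereal (f y)"
      using r by blast
    then show ?thesis
      using proper_fun_ereal[OF assms, of x] proper_fun_ereal[OF assms False] r
      by (metis ereal_less_eq(3) plus_ereal.simps(1))
  qed simp
  then show ?lhs by (simp add: subdifferential_def)
qed

text \<open>The affine minorant given by a subgradient excludes the value \<open>-\<infinity>\<close>.\<close>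

lemma proper_fun_if_subgradient:
  assumes "u \<in> subdifferential g w" "\<bar>g w\<bar> \<noteq> \<infinity>"
  shows "proper_fun g"
proof -
  have "g x \<noteq> -\<infinity>" for x
  proof -
    have "g w + ereal (u \<bullet> (x - w)) \<le> g x"
      using assms(1) by (simp add: subdifferential_def)
    then show ?thesis using assms(2) by (cases "g w") auto
  qed
  moreover have "g w \<noteq> \<infinity>" using assms(2) by auto
  ultimately show ?thesis unfolding proper_fun_def by blast
qed

lemma subdifferential_monotone:
  assumes "proper_fun f" "u \<in> subdifferential f x" "v \<in> subdifferential f y"
  shows "0 \<le> (u - v) \<bullet> (x - y)"
proof -
  have "real_of_ereal (f x) + u \<bullet> (y - x) \<le> real_of_ereal (f y)"
       "real_of_ereal (f y) + v \<bullet> (x - y) \<le> real_of_ereal (f x)"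
    using assms by (auto simp: subdifferential_iff)
  then show ?thesis
    by (simp add: inner_diff_left inner_diff_right)
qed

lemma subgradient_scaled_iff:
  assumes f: "proper_fun f" and c: "c > 0"
  shows "u \<in> subdifferential (\<lambda>v. f v / ereal c) x \<longleftrightarrow> c *\<^sub>R u \<in> subdifferential f x"
    and "proper_fun (\<lambda>v. f v / ereal c)"
proof -
  have inf: "f v / ereal c = \<infinity> \<longleftrightarrow> f v = \<infinity>" for v
    using f c unfolding proper_fun_def by (cases "f v") auto
  have "f v / ereal c \<noteq> -\<infinity>" for v
    using f c unfolding proper_fun_def by (cases "f v") auto
  then show p: "proper_fun (\<lambda>v. f v / ereal c)"
    using f unfolding proper_fun_def inf by blast
  have real: "real_of_ereal (f v / ereal c) = real_of_ereal (f v) / c" for v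
    by (cases "f v") (use c in auto)
  have "real_of_ereal (f x) / c + u \<bullet> (y - x) \<le> real_of_ereal (f y) / c \<longleftrightarrow>
      real_of_ereal (f x) + c *\<^sub>R u \<bullet> (y - x) \<le> real_of_ereal (f y)" for y
    using c mult_le_cancel_left_pos[of c "real_of_ereal (f x) / c + u \<bullet> (y - x)"
        "real_of_ereal (f y) / c"]
    by (simp add: distrib_left)
  then show "u \<in> subdifferential (\<lambda>v. f v / ereal c) x \<longleftrightarrow> c *\<^sub>R u \<in> subdifferential f x"
    unfolding subdifferential_iff[OF p] subdifferential_iff[OF f] inf real by simp
qed

section \<open>Existence of the minimizer\<close>

text \<open>The bounds vary with \<open>n\<close> because along a minimizing sequence of the regularized function the
  estimate for \<open>f (X n)\<close> contains the quadratic term at \<open>X n\<close>.\<close>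

lemma lsc_fun_limit_le:
  fixes X :: "nat \<Rightarrow> 'a::topological_space"
  assumes f: "lsc_fun f" and X: "X \<longlonglongrightarrow> x" and c: "c \<longlonglongrightarrow> b"
    and le: "\<And>n. f (X n) \<le> ereal (c n)"
  shows "f x \<le> ereal b"
proof (rule ccontr)
  assume "\<not> f x \<le> ereal b"
  then obtain r where r: "b < r" "ereal r < f x"
    using ereal_dense2[of "ereal b" "f x"] by (auto simp: not_le)
  then have "ereal r < Liminf (nhds x) f"
    using f unfolding lsc_fun_def by (meson less_le_trans)
  then have "eventually (\<lambda>v. ereal r < f v) (nhds x)"
    by (rule less_LiminfD)
  then have "eventually (\<lambda>n. ereal r < f (X n)) sequentially"
    using X by (rule eventually_compose_filterlim)
  moreover have "eventually (\<lambda>n. c n < r) sequentially"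
    using c r(1) by (rule order_tendstoD)
  ultimately have "eventually (\<lambda>n. False) sequentially"
  proof eventually_elim
    case (elim n)
    have "ereal r < ereal (c n)" using elim(1) le by (rule less_le_trans)
    with elim(2) show False by simp
  qed
  then show False by simp
qed

lemma convex_fun_real:
  assumes f: "proper_fun f" "convex_fun f" and x: "f x \<noteq> \<infinity>" and y: "f y \<noteq> \<infinity>"
    and t: "0 < t" "t < 1"
  shows "f ((1 - t) *\<^sub>R x + t *\<^sub>R y) \<noteq> \<infinity>"
    and "real_of_ereal (f ((1 - t) *\<^sub>R x + t *\<^sub>R y))
      \<le> (1 - t) * real_of_ereal (f x) + t * real_of_ereal (f y)"
proof -
  let ?z = "(1 - t) *\<^sub>R x + t *\<^sub>R y"
  have "f ?z \<le> ereal (1 - t) * f x + ereal t * f y"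
    using f(2) t unfolding convex_fun_def by blast
  also have "\<dots> = ereal ((1 - t) * real_of_ereal (f x) + t * real_of_ereal (f y))"
    using proper_fun_ereal[OF f(1) x] proper_fun_ereal[OF f(1) y]
    by (metis plus_ereal.simps(1) times_ereal.simps(1))
  finally have le: "f ?z \<le> ereal ((1 - t) * real_of_ereal (f x) + t * real_of_ereal (f y))" .
  then show z: "f ?z \<noteq> \<infinity>" by auto
  show "real_of_ereal (f ?z) \<le> (1 - t) * real_of_ereal (f x) + t * real_of_ereal (f y)"
    using le proper_fun_ereal[OF f(1) z] by (metis ereal_less_eq(3))
qed

text \<open>Near \<open>w\<close> semicontinuity gives \<open>f > f w - 1\<close>. For a far point \<open>x\<close>, this bound holds at the
  point of the segment from \<open>w\<close> to \<open>x\<close> at a fixed small distance from \<open>w\<close>, and convexity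
  extrapolates it linearly out to \<open>x\<close>.\<close>

lemma convex_lsc_lower_bound:
  fixes f :: "'a::real_inner \<Rightarrow> ereal"
  assumes f: "proper_fun f" "lsc_fun f" "convex_fun f" and w: "f w \<noteq> \<infinity>"
  obtains K where "K > 0"
    and "\<And>x. f x \<noteq> \<infinity> \<Longrightarrow> real_of_ereal (f w) - 1 - K * norm (x - w) \<le> real_of_ereal (f x)"
proof -
  let ?g = "\<lambda>x. real_of_ereal (f x)"
  have "ereal (?g w - 1) < f w"
    using proper_fun_ereal[OF f(1) w] by (metis diff_less_eq less_add_one less_ereal.simps(1))
  then have "ereal (?g w - 1) < Liminf (nhds w) f"
    using f(2) unfolding lsc_fun_def by (meson less_le_trans)
  then have "eventually (\<lambda>v. ereal (?g w - 1) < f v) (nhds w)"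
    by (rule less_LiminfD)
  then obtain d where d: "d > 0" "\<And>v. dist v w < d \<Longrightarrow> ereal (?g w - 1) < f v"
    unfolding eventually_nhds_metric by blast
  have near: "?g w - 1 < ?g v" if "dist v w < d" "f v \<noteq> \<infinity>" for v
    using d(2)[OF that(1)] proper_fun_ereal[OF f(1) that(2)] by (metis less_ereal.simps(1))
  have "?g w - 1 - 2 / d * norm (x - w) \<le> ?g x" if x: "f x \<noteq> \<infinity>" for x
  proof (cases "dist x w < d")
    case True
    have "0 \<le> 2 / d * norm (x - w)" using d(1) by simp
    with near[OF True x] show ?thesis by linarith
  next
    case False
    define n where "n = norm (x - w)"
    define t where "t = d / (2 * n)"
    have n: "n \<ge> d" using False by (simp add: n_def dist_norm)
    then have t: "0 < t" "t < 1"
      using d(1) by (auto simp: t_def field_simps)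
    let ?v = "(1 - t) *\<^sub>R w + t *\<^sub>R x"
    have "?v - w = t *\<^sub>R (x - w)" by (simp add: algebra_simps)
    then have "dist ?v w = t * n"
      using t by (simp add: dist_norm n_def)
    also have "\<dots> < d" using n d(1) by (simp add: t_def)
    finally have "?g w - 1 < ?g ?v"
      using near convex_fun_real(1)[OF f(1,3) w x t] by blast
    also have "\<dots> \<le> (1 - t) * ?g w + t * ?g x"
      by (rule convex_fun_real(2)[OF f(1,3) w x t])
    finally have "t * (?g w - ?g x) < 1"
      by (simp add: algebra_simps)
    then have "?g w - ?g x < 1 / t"
      using t by (simp add: field_simps)
    also have "1 / t = 2 / d * n"
      using n d(1) by (simp add: t_def)
    finally show ?thesis by (simp add: n_def)
  qed
  then show thesis using d(1) that[of "2 / d"] by simp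
qed

lemma convex_lsc_regularized_bounded_below:
  fixes f :: "'a::real_inner \<Rightarrow> ereal"
  assumes f: "proper_fun f" "lsc_fun f" "convex_fun f" and c: "c > 0"
  obtains B where "\<And>x. f x \<noteq> \<infinity> \<Longrightarrow> B \<le> real_of_ereal (f x) + c / 2 * (norm (x - y))\<^sup>2"
proof -
  let ?g = "\<lambda>x. real_of_ereal (f x)"
  obtain w where w: "f w \<noteq> \<infinity>"
    using f(1) unfolding proper_fun_def by blast
  obtain K where K: "K > 0" "\<And>x. f x \<noteq> \<infinity> \<Longrightarrow> ?g w - 1 - K * norm (x - w) \<le> ?g x"
    using convex_lsc_lower_bound[OF f w] by blast
  \<comment> \<open>\<open>- K\<^sup>2 / (2 c)\<close> is the minimum of \<open>c / 2 * s\<^sup>2 - K * s\<close> over real \<open>s\<close>.\<close>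
  have "?g w - 1 - K * norm (y - w) - K\<^sup>2 / (2 * c) \<le> ?g x + c / 2 * (norm (x - y))\<^sup>2"
    if x: "f x \<noteq> \<infinity>" for x
  proof -
    let ?s = "norm (x - y)"
    have "norm (x - w) \<le> ?s + norm (y - w)"
      using norm_triangle_ineq[of "x - y" "y - w"] by simp
    then have 1: "K * norm (x - w) \<le> K * ?s + K * norm (y - w)"
      using K(1) by (metis distrib_left less_eq_real_def mult_left_mono)
    have "c / 2 * ?s\<^sup>2 - K * ?s + K\<^sup>2 / (2 * c) = (c * ?s - K)\<^sup>2 / (2 * c)"
      using c by (simp add: field_simps power2_eq_square)
    also have "\<dots> \<ge> 0" using c by simp
    finally show ?thesis using K(2)[OF x] 1 by linarith
  qed
  then show thesis by (rule that)
qed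

text \<open>At the midpoint of \<open>a\<close> and \<open>b\<close> the parallelogram law improves the convexity estimate by
  \<open>(c/8) \<parallel>a - b\<parallel>\<^sup>2\<close>; near-minimizers are therefore close to each other.\<close>

lemma regularized_near_minimizers_close:
  fixes f :: "'a::real_inner \<Rightarrow> ereal"
  assumes f: "proper_fun f" "convex_fun f"
    and m: "\<And>x. f x \<noteq> \<infinity> \<Longrightarrow> m \<le> real_of_ereal (f x) + c / 2 * (norm (x - y))\<^sup>2"
    and a: "f a \<noteq> \<infinity>" "real_of_ereal (f a) + c / 2 * (norm (a - y))\<^sup>2 \<le> m + e"
    and b: "f b \<noteq> \<infinity>" "real_of_ereal (f b) + c / 2 * (norm (b - y))\<^sup>2 \<le> m + e"
  shows "c / 8 * (norm (a - b))\<^sup>2 \<le> e"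
proof -
  let ?g = "\<lambda>x. real_of_ereal (f x)"
  let ?z = "(1 - 1/2) *\<^sub>R a + (1/2) *\<^sub>R b"
  have z: "f ?z \<noteq> \<infinity>" "?g ?z \<le> (1 - 1/2) * ?g a + 1/2 * ?g b"
    using convex_fun_real[OF f a(1) b(1), of "1/2"] by simp_all
  have "?z - y = (1/2) *\<^sub>R ((a - y) + (b - y))"
    by (simp add: algebra_simps flip: scaleR_add_left)
  then have "(norm (?z - y))\<^sup>2 = (norm ((a - y) + (b - y)))\<^sup>2 / 4"
    by (simp add: power_divide)
  also have "\<dots> = (norm (a - y))\<^sup>2 / 2 + (norm (b - y))\<^sup>2 / 2 - (norm (a - b))\<^sup>2 / 4"
    by (simp add: power2_norm_eq_inner inner_diff_left inner_diff_right inner_add_left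
        inner_add_right inner_commute field_simps)
  finally have parallelogram: "(norm (?z - y))\<^sup>2
      = (norm (a - y))\<^sup>2 / 2 + (norm (b - y))\<^sup>2 / 2 - (norm (a - b))\<^sup>2 / 4" .
  have eq: "c / 2 * (norm (?z - y))\<^sup>2
      = (c / 2 * (norm (a - y))\<^sup>2) / 2 + (c / 2 * (norm (b - y))\<^sup>2) / 2
        - c / 8 * (norm (a - b))\<^sup>2"
    unfolding parallelogram by (simp add: field_simps)
  show ?thesis using m[OF z(1)] z(2) a(2) b(2) unfolding eq by simp
qed

lemma regularized_minimizer_exists:
  fixes f :: "'a::{real_inner, complete_space} \<Rightarrow> ereal"
  assumes f: "proper_fun f" "lsc_fun f" "convex_fun f" and c: "c > 0"
  obtains x where "f x \<noteq> \<infinity>"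
    and "\<And>v. f v \<noteq> \<infinity> \<Longrightarrow>
      real_of_ereal (f x) + c / 2 * (norm (x - y))\<^sup>2
        \<le> real_of_ereal (f v) + c / 2 * (norm (v - y))\<^sup>2"
proof -
  let ?g = "\<lambda>x. real_of_ereal (f x)"
  let ?h = "\<lambda>x. ?g x + c / 2 * (norm (x - y))\<^sup>2"
  let ?D = "{x. f x \<noteq> \<infinity>}"
  obtain B where B: "\<And>x. f x \<noteq> \<infinity> \<Longrightarrow> B \<le> ?h x"
    using convex_lsc_regularized_bounded_below[OF f c] by blast
  have bdd: "bdd_below (?h ` ?D)" by (rule bdd_belowI2) (use B in auto)
  have ne: "?h ` ?D \<noteq> {}" using f(1) unfolding proper_fun_def by blast
  define m where "m = Inf (?h ` ?D)"
  have m: "m \<le> ?h x" if "f x \<noteq> \<infinity>" for x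
    unfolding m_def using bdd that by (intro cInf_lower) auto
  have "\<exists>x. f x \<noteq> \<infinity> \<and> ?h x < m + 1 / real (Suc n)" for n
  proof -
    have "Inf (?h ` ?D) < m + 1 / real (Suc n)" by (simp add: m_def)
    then show ?thesis using cInf_less_iff[OF ne bdd] by auto
  qed
  then obtain X where X: "\<And>n. f (X n) \<noteq> \<infinity>" "\<And>n. ?h (X n) < m + 1 / real (Suc n)"
    by metis
  have "Cauchy X"
  proof (rule metric_CauchyI)
    fix e :: real assume e: "0 < e"
    then obtain N where N: "1 / real (Suc N) < c / 8 * e\<^sup>2"
      using c reals_Archimedean[of "c / 8 * e\<^sup>2"] by (auto simp: inverse_eq_divide)
    have "dist (X i) (X j) < e" if "i \<ge> N" "j \<ge> N" for i j
    proof -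
      have "1 / real (Suc k) \<le> 1 / real (Suc N)" if "k \<ge> N" for k
        using that by (simp add: frac_le)
      then have "?h (X i) \<le> m + 1 / real (Suc N)" "?h (X j) \<le> m + 1 / real (Suc N)"
        using X(2)[of i] X(2)[of j] that by (smt (verit))+
      then have "c / 8 * (norm (X i - X j))\<^sup>2 \<le> 1 / real (Suc N)"
        by (intro regularized_near_minimizers_close[OF f(1,3) m]) (use X(1) in auto)
      then have "(norm (X i - X j))\<^sup>2 < e\<^sup>2"
        using N c by (smt (verit) mult_left_mono divide_pos_pos)
      then show ?thesis
        using e by (simp add: dist_norm power2_less_imp_less)
    qed
    then show "\<exists>M. \<forall>i\<ge>M. \<forall>j\<ge>M. dist (X i) (X j) < e" by blast
  qed
  then obtain x where lim: "X \<longlonglongrightarrow> x"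
    using Cauchy_convergent convergent_def by blast
  have "(\<lambda>n. m + 1 / real (Suc n) - c / 2 * (norm (X n - y))\<^sup>2)
      \<longlonglongrightarrow> m + 0 - c / 2 * (norm (x - y))\<^sup>2"
    by (intro tendsto_intros lim LIMSEQ_Suc[OF lim_1_over_n])
  moreover have "f (X n) \<le> ereal (m + 1 / real (Suc n) - c / 2 * (norm (X n - y))\<^sup>2)" for n
    using X(2)[of n] by (subst proper_fun_ereal[OF f(1) X(1)]) simp
  ultimately have le: "f x \<le> ereal (m + 0 - c / 2 * (norm (x - y))\<^sup>2)"
    by (rule lsc_fun_limit_le[OF f(2) lim])
  then have fin: "f x \<noteq> \<infinity>" by auto
  then have "?g x \<le> m + 0 - c / 2 * (norm (x - y))\<^sup>2"
    using le proper_fun_ereal[OF f(1) fin] by (metis ereal_less_eq(3))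
  then have hx: "?h x \<le> m" by simp
  show thesis
    by (rule that[OF fin]) (use hx m in \<open>meson order_trans\<close>)
qed

text \<open>Minty's theorem with a parameter. Comparing the minimizer \<open>x\<close> with the points
  \<open>x + t (v - x)\<close> and letting \<open>t\<close> tend to \<open>0\<close> is Fermat's rule for the regularized function.\<close>

lemma resolvent_exists:
  fixes f :: "'a::{real_inner, complete_space} \<Rightarrow> ereal"
  assumes f: "proper_fun f" "lsc_fun f" "convex_fun f" and c: "c > 0"
  obtains x where "c *\<^sub>R (y - x) \<in> subdifferential f x"
proof -
  let ?g = "\<lambda>x. real_of_ereal (f x)"
  obtain x where x: "f x \<noteq> \<infinity>"
    and min: "\<And>v. f v \<noteq> \<infinity> \<Longrightarrow>
      ?g x + c / 2 * (norm (x - y))\<^sup>2 \<le> ?g v + c / 2 * (norm (v - y))\<^sup>2"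
    using regularized_minimizer_exists[OF f c] by blast
  have "?g x + c *\<^sub>R (y - x) \<bullet> (v - x) \<le> ?g v" if v: "f v \<noteq> \<infinity>" for v
  proof -
    define A where "A = ?g v - ?g x - c *\<^sub>R (y - x) \<bullet> (v - x)"
    define q where "q = c / 2 * (norm (v - x))\<^sup>2"
    have bound: "0 \<le> A + t * q" if t: "0 < t" "t < 1" for t
    proof -
      let ?z = "(1 - t) *\<^sub>R x + t *\<^sub>R v"
      have zy: "?z - y = (x - y) + t *\<^sub>R (v - x)" by (simp add: algebra_simps)
      have expand: "(norm (?z - y))\<^sup>2
          = (norm (x - y))\<^sup>2 - 2 * t * ((y - x) \<bullet> (v - x)) + t\<^sup>2 * (norm (v - x))\<^sup>2"
        unfolding zy power2_norm_eq_inner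
        by (simp add: inner_diff_left inner_diff_right inner_add_left inner_add_right
            inner_commute power2_eq_square algebra_simps)
      have eq: "c / 2 * (norm (?z - y))\<^sup>2
          = c / 2 * (norm (x - y))\<^sup>2 - t * (c *\<^sub>R (y - x) \<bullet> (v - x)) + t * (t * q)"
        unfolding expand by (simp add: q_def power2_eq_square algebra_simps)
      have "?g x + c / 2 * (norm (x - y))\<^sup>2 \<le> ?g ?z + c / 2 * (norm (?z - y))\<^sup>2"
        by (rule min[OF convex_fun_real(1)[OF f(1,3) x v t]])
      moreover have "?g ?z \<le> (1 - t) * ?g x + t * ?g v"
        by (rule convex_fun_real(2)[OF f(1,3) x v t])
      ultimately have "0 \<le> t * (A + t * q)"
        unfolding eq A_def by (simp add: algebra_simps)
      then show ?thesis using t by (simp add: zero_le_mult_iff)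
    qed
    have "eventually (\<lambda>t. 0 < t \<and> t < 1) (at_right (0::real))"
      by (auto simp: eventually_at_right_field intro: exI[of _ 1])
    then have "eventually (\<lambda>t. 0 \<le> A + t * q) (at_right 0)"
      by (rule eventually_mono) (use bound in auto)
    moreover have "((\<lambda>t. A + t * q) \<longlongrightarrow> A + 0 * q) (at_right 0)"
      by (intro tendsto_intros)
    ultimately have "0 \<le> A + 0 * q"
      by (intro tendsto_lowerbound[where F = "at_right 0"]) auto
    then show ?thesis by (simp add: A_def)
  qed
  with x have "c *\<^sub>R (y - x) \<in> subdifferential f x"
    unfolding subdifferential_iff[OF f(1)] by blast
  then show thesis by (rule that)
qed

section \<open>Proximal mappings\<close>

text \<open>For two solutions \<open>x\<close> and \<open>x'\<close> of the inclusion, the subgradients \<open>y - x\<close> and \<open>y - x'\<close> differ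
  by \<open>x' - x\<close>, so monotonicity reads \<open>- \<parallel>x' - x\<parallel>\<^sup>2 \<ge> 0\<close>. This uniqueness is what the description
  operator needs.\<close>

lemma Prox_eqI:
  assumes f: "proper_fun f" and x: "y - x \<in> subdifferential f x"
  shows "Prox f y = x"
  unfolding Prox_def
proof (rule the_equality)
  show "y \<in> {x + u |u. u \<in> subdifferential f x}"
    using x by (auto intro!: exI[of _ "y - x"])
next
  fix x' assume "y \<in> {x' + u |u. u \<in> subdifferential f x'}"
  then have "y - x' \<in> subdifferential f x'" by auto
  from subdifferential_monotone[OF f this x]
  have "0 \<le> (x - x') \<bullet> (x' - x)" by simp
  then have "(x' - x) \<bullet> (x' - x) \<le> 0"
    by (simp add: inner_diff_left inner_diff_right)
  then show "x' = x" by (metis eq_iff_diff_eq_0 inner_gt_zero_iff not_le)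
qed

text \<open>Scaling \<open>f\<close> by \<open>1/c\<close> scales its subgradients; this turns the two equations that define
  \<open>prox_pairs\<close> into inclusions for the unscaled functions.\<close>

lemma Prox_scaled_iff:
  fixes f :: "'a::{real_inner, complete_space} \<Rightarrow> ereal"
  assumes f: "proper_fun f" "lsc_fun f" "convex_fun f" and c: "c > 0"
  shows "x = Prox (\<lambda>v. f v / ereal c) y \<longleftrightarrow> c *\<^sub>R (y - x) \<in> subdifferential f x"
proof -
  have eq: "Prox (\<lambda>v. f v / ereal c) y = x'"
    if "c *\<^sub>R (y - x') \<in> subdifferential f x'" for x'
    using that by (intro Prox_eqI subgradient_scaled_iff(2)[OF f(1) c])
      (simp add: subgradient_scaled_iff(1)[OF f(1) c])
  obtain x' where x': "c *\<^sub>R (y - x') \<in> subdifferential f x'"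
    using resolvent_exists[OF f c] by blast
  show ?thesis using eq[OF x'] eq[of x] x' by auto
qed

lemma Prox_iff:
  fixes f :: "'a::{real_inner, complete_space} \<Rightarrow> ereal"
  assumes "proper_fun f" "lsc_fun f" "convex_fun f"
  shows "x = Prox f y \<longleftrightarrow> y - x \<in> subdifferential f x"
proof -
  have "f v / ereal 1 = f v" for v by (cases "f v") simp_all
  then show ?thesis using Prox_scaled_iff[OF assms, of 1 x y] by simp
qed

lemma Prox_subgradient:
  fixes f :: "'a::{real_inner, complete_space} \<Rightarrow> ereal"
  assumes "proper_fun f" "lsc_fun f" "convex_fun f"
  shows "y - Prox f y \<in> subdifferential f (Prox f y)"
  using Prox_iff[OF assms, of "Prox f y" y] by simp

text \<open>Monotonicity of the subdifferential gives
  \<open>\<parallel>Prox f y - Prox f z\<parallel>\<^sup>2 \<le> (y - z) \<bullet> (Prox f y - Prox f z)\<close>; the rest is Cauchy-Schwarz.\<close>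

lemma Prox_nonexpansive:
  fixes f :: "'a::{real_inner, complete_space} \<Rightarrow> ereal"
  assumes f: "proper_fun f" "lsc_fun f" "convex_fun f"
  shows "norm (Prox f y - Prox f z) \<le> norm (y - z)"
proof -
  let ?d = "Prox f y - Prox f z"
  have "0 \<le> ((y - Prox f y) - (z - Prox f z)) \<bullet> ?d"
    by (rule subdifferential_monotone[OF f(1) Prox_subgradient[OF f] Prox_subgradient[OF f]])
  also have "\<dots> = (y - z) \<bullet> ?d - (norm ?d)\<^sup>2"
    by (simp add: power2_norm_eq_inner inner_diff_left inner_diff_right)
  finally have "(norm ?d)\<^sup>2 \<le> norm (y - z) * norm ?d"
    using norm_cauchy_schwarz[of "y - z" ?d] by linarith
  then show ?thesis
    by (cases "norm ?d = 0") (auto simp: power2_eq_square)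
qed

lemma continuous_on_Prox:
  fixes f :: "'a::{real_inner, complete_space} \<Rightarrow> ereal"
  assumes "proper_fun f" "lsc_fun f" "convex_fun f"
  shows "continuous_on A (Prox f)"
proof -
  have "1-lipschitz_on A (Prox f)"
    by (rule lipschitz_onI) (use Prox_nonexpansive[OF assms] in \<open>auto simp: dist_norm\<close>)
  then show ?thesis by (rule lipschitz_on_continuous_on)
qed

section \<open>The proximal average\<close>

text \<open>The weighted sum of the inner products on the right equals the inner product on the left
  minus \<open>l\<^sub>1 l\<^sub>2 (a - b) \<bullet> ((x - y) - (a - b))\<close>. Expanding \<open>\<parallel>x - y\<parallel>\<^sup>2\<close> around \<open>a - b\<close> cancels this
  term, and the right side exceeds the left by \<open>(l\<^sub>1 l\<^sub>2/2) \<parallel>(x - y) - (a - b)\<parallel>\<^sup>2\<close>.\<close>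

lemma prox_avg_inner_inequality:
  fixes a b x y z :: "'a::real_inner"
  assumes l: "l\<^sub>1 > 0" "l\<^sub>2 > 0" "l\<^sub>1 + l\<^sub>2 = 1" and w: "w = l\<^sub>1 *\<^sub>R a + l\<^sub>2 *\<^sub>R b"
  shows "(z - w) \<bullet> (l\<^sub>1 *\<^sub>R x + l\<^sub>2 *\<^sub>R y - w) + l\<^sub>1 * l\<^sub>2 / 2 * (norm (a - b))\<^sup>2
    \<le> l\<^sub>1 * ((z - a) \<bullet> (x - a)) + l\<^sub>2 * ((z - b) \<bullet> (y - b)) + l\<^sub>1 * l\<^sub>2 / 2 * (norm (x - y))\<^sup>2"
proof -
  let ?s = "x - a" and ?t = "y - b" and ?d = "a - b"
  have l2: "l\<^sub>2 = 1 - l\<^sub>1" using l(3) by simp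
  have za: "z - a = (z - w) - l\<^sub>2 *\<^sub>R ?d" and zb: "z - b = (z - w) + l\<^sub>1 *\<^sub>R ?d"
    by (simp_all add: w l2 algebra_simps)
  have yw: "l\<^sub>1 *\<^sub>R x + l\<^sub>2 *\<^sub>R y - w = l\<^sub>1 *\<^sub>R ?s + l\<^sub>2 *\<^sub>R ?t"
    by (simp add: w algebra_simps)
  have xy: "x - y = ?d + (?s - ?t)" by simp
  have nxy: "(norm (x - y))\<^sup>2 = (norm ?d)\<^sup>2 + 2 * (?d \<bullet> (?s - ?t)) + (norm (?s - ?t))\<^sup>2"
    unfolding xy power2_norm_eq_inner
    by (simp only: inner_add_left inner_add_right inner_commute[of "?s - ?t" ?d])
  have "l\<^sub>1 * ((z - a) \<bullet> ?s) + l\<^sub>2 * ((z - b) \<bullet> ?t)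
      = (z - w) \<bullet> (l\<^sub>1 *\<^sub>R ?s + l\<^sub>2 *\<^sub>R ?t) - l\<^sub>1 * l\<^sub>2 * (?d \<bullet> (?s - ?t))"
    unfolding za zb
    by (simp only: inner_add_left inner_add_right inner_diff_left[of "z - w"]
        inner_diff_right[of ?d ?s ?t] inner_scaleR_left inner_scaleR_right) (simp add: algebra_simps)
  moreover have "0 \<le> l\<^sub>1 * l\<^sub>2 / 2 * (norm (?s - ?t))\<^sup>2" using l by simp
  ultimately show ?thesis unfolding nxy yw by (simp add: algebra_simps)
qed

text \<open>With \<open>a = Prox f\<^sub>1 z\<close>, \<open>b = Prox f\<^sub>2 z\<close> and \<open>w = l\<^sub>1 a + l\<^sub>2 b\<close>, the subgradient inequalities of \<open>f\<^sub>1\<close>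
  at \<open>a\<close> and \<open>f\<^sub>2\<close> at \<open>b\<close> bound every competitor in the infimum from below by an affine function with
  slope \<open>z - w\<close>. The pair \<open>(a, b)\<close> attains this bound at \<open>w\<close>, so \<open>z - w\<close> is a subgradient of the
  proximal average at \<open>w\<close>.\<close>

lemma Prox_prox_avg:
  fixes f\<^sub>1 f\<^sub>2 :: "'a::{real_inner, complete_space} \<Rightarrow> ereal"
  assumes f1: "proper_fun f\<^sub>1" "lsc_fun f\<^sub>1" "convex_fun f\<^sub>1"
    and f2: "proper_fun f\<^sub>2" "lsc_fun f\<^sub>2" "convex_fun f\<^sub>2"
    and l: "l\<^sub>1 > 0" "l\<^sub>2 > 0" "l\<^sub>1 + l\<^sub>2 = 1"
  shows "Prox (prox_avg l\<^sub>1 l\<^sub>2 f\<^sub>1 f\<^sub>2) z = l\<^sub>1 *\<^sub>R Prox f\<^sub>1 z + l\<^sub>2 *\<^sub>R Prox f\<^sub>2 z"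
proof -
  let ?p = "prox_avg l\<^sub>1 l\<^sub>2 f\<^sub>1 f\<^sub>2"
  let ?g1 = "\<lambda>x. real_of_ereal (f\<^sub>1 x)" and ?g2 = "\<lambda>x. real_of_ereal (f\<^sub>2 x)"
  define a where "a = Prox f\<^sub>1 z"
  define b where "b = Prox f\<^sub>2 z"
  define w where "w = l\<^sub>1 *\<^sub>R a + l\<^sub>2 *\<^sub>R b"
  define k where "k = l\<^sub>1 * ?g1 a + l\<^sub>2 * ?g2 b + l\<^sub>1 * l\<^sub>2 / 2 * (norm (a - b))\<^sup>2"
  have a: "f\<^sub>1 a \<noteq> \<infinity>"
      "\<And>x. f\<^sub>1 x \<noteq> \<infinity> \<Longrightarrow> ?g1 a + (z - a) \<bullet> (x - a) \<le> ?g1 x"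
    using Prox_subgradient[OF f1, of z] unfolding a_def subdifferential_iff[OF f1(1)] by auto
  have b: "f\<^sub>2 b \<noteq> \<infinity>"
      "\<And>x. f\<^sub>2 x \<noteq> \<infinity> \<Longrightarrow> ?g2 b + (z - b) \<bullet> (x - b) \<le> ?g2 x"
    using Prox_subgradient[OF f2, of z] unfolding b_def subdifferential_iff[OF f2(1)] by auto
  have split: "ereal l\<^sub>1 * f\<^sub>1 x + ereal l\<^sub>2 * f\<^sub>2 y + ereal r = ereal (l\<^sub>1 * ?g1 x + l\<^sub>2 * ?g2 y + r)"
    if "f\<^sub>1 x \<noteq> \<infinity>" "f\<^sub>2 y \<noteq> \<infinity>" for x y r
    using that f1(1) f2(1) unfolding proper_fun_def
    by (cases "f\<^sub>1 x"; cases "f\<^sub>2 y") auto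
  have inf: "ereal l\<^sub>1 * f\<^sub>1 x + ereal l\<^sub>2 * f\<^sub>2 y + ereal r = \<infinity>"
    if "f\<^sub>1 x = \<infinity> \<or> f\<^sub>2 y = \<infinity>" for x y r
    using that f1(1) f2(1) l(1,2) unfolding proper_fun_def
    by (cases "f\<^sub>1 x"; cases "f\<^sub>2 y") auto
  have minorant: "ereal (k + (z - w) \<bullet> (v - w)) \<le> ?p v" for v
    unfolding prox_avg_def
  proof (rule INF_greatest, clarify)
    fix x y assume v: "v = l\<^sub>1 *\<^sub>R x + l\<^sub>2 *\<^sub>R y"
    let ?r = "l\<^sub>1 * l\<^sub>2 / 2 * (norm (x - y))\<^sup>2"
    show "ereal (k + (z - w) \<bullet> (l\<^sub>1 *\<^sub>R x + l\<^sub>2 *\<^sub>R y - w))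
        \<le> ereal l\<^sub>1 * f\<^sub>1 x + ereal l\<^sub>2 * f\<^sub>2 y + ereal ?r"
    proof (cases "f\<^sub>1 x = \<infinity> \<or> f\<^sub>2 y = \<infinity>")
      case True
      then show ?thesis by (simp add: inf)
    next
      case False
      have "l\<^sub>1 * (?g1 a + (z - a) \<bullet> (x - a)) \<le> l\<^sub>1 * ?g1 x"
        using a(2) False l(1) by simp
      moreover have "l\<^sub>2 * (?g2 b + (z - b) \<bullet> (y - b)) \<le> l\<^sub>2 * ?g2 y"
        using b(2) False l(2) by simp
      ultimately have "k + (z - w) \<bullet> (l\<^sub>1 *\<^sub>R x + l\<^sub>2 *\<^sub>R y - w)
          \<le> l\<^sub>1 * ?g1 x + l\<^sub>2 * ?g2 y + ?r"
        using prox_avg_inner_inequality[OF l w_def, of z x y] unfolding k_def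
        by (simp add: distrib_left)
      then show ?thesis using False by (subst split) auto
    qed
  qed
  have "?p w \<le> ereal l\<^sub>1 * f\<^sub>1 a + ereal l\<^sub>2 * f\<^sub>2 b + ereal (l\<^sub>1 * l\<^sub>2 / 2 * (norm (a - b))\<^sup>2)"
    unfolding prox_avg_def by (rule INF_lower2[of "(a, b)"]) (auto simp: w_def)
  also have "\<dots> = ereal k" using a(1) b(1) by (simp add: split k_def)
  finally have pw: "?p w = ereal k"
    using minorant[of w] by (simp add: antisym)
  have "z - w \<in> subdifferential ?p w"
    using minorant by (simp add: subdifferential_def pw)
  then have "Prox ?p z = w"
    by (intro Prox_eqI proper_fun_if_subgradient[of "z - w" ?p w]) (simp_all add: pw)
  then show ?thesis by (simp add: w_def a_def b_def)
qed

section \<open>The homeomorphism\<close>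

text \<open>The two scaled resolvent equations, each with the other unknown as its argument, become
  unscaled ones with the common argument \<open>l\<^sub>1 x + l\<^sub>2 y\<close>. Hence a pair is determined by its image
  under \<open>T\<close>.\<close>

lemma mem_prox_pairs_iff:
  fixes f\<^sub>1 f\<^sub>2 :: "'a::{real_inner, complete_space} \<Rightarrow> ereal"
  assumes f1: "proper_fun f\<^sub>1" "lsc_fun f\<^sub>1" "convex_fun f\<^sub>1"
    and f2: "proper_fun f\<^sub>2" "lsc_fun f\<^sub>2" "convex_fun f\<^sub>2"
    and l: "l\<^sub>1 > 0" "l\<^sub>2 > 0" "l\<^sub>1 + l\<^sub>2 = 1"
  shows "(x, y) \<in> prox_pairs l\<^sub>1 l\<^sub>2 f\<^sub>1 f\<^sub>2 \<longleftrightarrow>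
    x = Prox f\<^sub>1 (l\<^sub>1 *\<^sub>R x + l\<^sub>2 *\<^sub>R y) \<and> y = Prox f\<^sub>2 (l\<^sub>1 *\<^sub>R x + l\<^sub>2 *\<^sub>R y)"
proof -
  have l1: "l\<^sub>1 = 1 - l\<^sub>2" using l(3) by simp
  have "l\<^sub>1 *\<^sub>R x + l\<^sub>2 *\<^sub>R y - x = l\<^sub>2 *\<^sub>R (y - x)" "l\<^sub>1 *\<^sub>R x + l\<^sub>2 *\<^sub>R y - y = l\<^sub>1 *\<^sub>R (x - y)"
    by (simp_all add: l1 algebra_simps)
  then show ?thesis
    unfolding Prox_iff[OF f1] Prox_iff[OF f2]
    by (simp add: prox_pairs_def Prox_scaled_iff[OF f1 l(2)] Prox_scaled_iff[OF f2 l(1)])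
qed

theorem theorem4p14:
  fixes f\<^sub>1 f\<^sub>2 :: "'a::{real_inner, complete_space} \<Rightarrow> ereal"
    and l\<^sub>1 l\<^sub>2 :: real
    and S :: "('a \<times> 'a) set"
    and L T :: "'a \<times> 'a \<Rightarrow> 'a"
    and p :: "'a \<Rightarrow> ereal"
  assumes "proper_fun f\<^sub>1" "lsc_fun f\<^sub>1" "convex_fun f\<^sub>1"
    and "proper_fun f\<^sub>2" "lsc_fun f\<^sub>2" "convex_fun f\<^sub>2"
    and "l\<^sub>1 > 0" "l\<^sub>2 > 0" "l\<^sub>1 + l\<^sub>2 = 1"
  defines "S \<equiv> prox_pairs l\<^sub>1 l\<^sub>2 f\<^sub>1 f\<^sub>2"
    and "L \<equiv> (\<lambda>(x, y). l\<^sub>1 *\<^sub>R x + l\<^sub>2 *\<^sub>R y)"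
    and "T \<equiv> restrict (\<lambda>(x, y). l\<^sub>1 *\<^sub>R x + l\<^sub>2 *\<^sub>R y) S"
    and "p \<equiv> prox_avg l\<^sub>1 l\<^sub>2 f\<^sub>1 f\<^sub>2"
  shows "homeomorphism S (Fix (\<lambda>z. l\<^sub>1 *\<^sub>R Prox f\<^sub>1 z + l\<^sub>2 *\<^sub>R Prox f\<^sub>2 z)) T (inv_into S T)
    \<and> (\<forall>z \<in> Fix (Prox p). inv_into S T z = (Prox f\<^sub>1 z, Prox f\<^sub>2 z))
    \<and> Fix (\<lambda>z. l\<^sub>1 *\<^sub>R Prox f\<^sub>1 z + l\<^sub>2 *\<^sub>R Prox f\<^sub>2 z) = L ` S"
proof -
  let ?R = "\<lambda>z. (Prox f\<^sub>1 z, Prox f\<^sub>2 z)"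
  let ?F = "Fix (\<lambda>z. l\<^sub>1 *\<^sub>R Prox f\<^sub>1 z + l\<^sub>2 *\<^sub>R Prox f\<^sub>2 z)"
  have TL: "T s = L s" if "s \<in> S" for s
    using that by (simp add: T_def L_def)
  have S_iff: "s \<in> S \<longleftrightarrow> ?R (L s) = s" for s
    using mem_prox_pairs_iff[OF assms(1-9), of "fst s" "snd s"]
    unfolding S_def L_def by (cases s) auto
  have F_iff: "z \<in> ?F \<longleftrightarrow> L (?R z) = z" for z
    by (simp add: Fix_def L_def)
  have S_F: "L s \<in> ?F" if "s \<in> S" for s
    using that unfolding S_iff F_iff by simp
  have F_S: "?R z \<in> S" if "z \<in> ?F" for z
    using that unfolding S_iff F_iff by simp
  have image: "?F = L ` S"
  proof (intro subset_antisym subsetI)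
    fix z assume z: "z \<in> ?F"
    show "z \<in> L ` S"
      by (rule image_eqI[of _ _ "?R z"]) (use z F_S F_iff in auto)
  qed (use S_F in auto)
  have inj: "inj_on T S"
  proof (rule inj_onI)
    fix s s' assume s: "s \<in> S" "s' \<in> S" "T s = T s'"
    then have "L s = L s'" by (simp add: TL)
    then have "?R (L s) = ?R (L s')" by (simp only:)
    also have "?R (L s) = s" using s(1) unfolding S_iff .
    also have "?R (L s') = s'" using s(2) unfolding S_iff .
    finally show "s = s'" .
  qed
  have inv: "inv_into S T z = ?R z" if "z \<in> ?F" for z
    by (rule inv_into_f_eq[OF inj]) (use F_S F_iff TL that in auto)
  have TS: "T ` S = ?F"
    unfolding image using TL by (rule image_cong[OF refl])
  have inv_image: "inv_into S T ` ?F = S"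
    unfolding TS[symmetric] by (rule inv_into_image_cancel[OF inj subset_refl])
  have "continuous_on S L"
    unfolding L_def case_prod_beta by (intro continuous_intros)
  then have cont: "continuous_on S T"
    by (rule continuous_on_eq) (simp add: TL)
  have "continuous_on ?F ?R"
    by (intro continuous_on_Pair continuous_on_Prox assms)
  then have cont_inv: "continuous_on ?F (inv_into S T)"
    by (rule continuous_on_eq) (simp add: inv)
  have "homeomorphism S ?F T (inv_into S T)"
    unfolding homeomorphism_def using cont cont_inv TS inv_image inj
    by (simp add: f_inv_into_f)
  moreover have "Fix (Prox p) = ?F"
    unfolding Fix_def p_def Prox_prox_avg[OF assms(1-9)] ..
  ultimately show ?thesis using inv image by auto
qed

end
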